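(* For every $\varepsilon>0$ there exists $t_0$ such that for every integer $t\geq t_0$ there is a graph $G$ with a $t$-thick partition $\mathcal P$ of $V(G)$ such that the maximum block average degree of $\mathcal P$ is at most $(\frac14+\varepsilon)t$, the local degree of $G$ with respect to $\mathcal P$ is at most $0.731t$, and $\mathcal P$ has no independent transversal in $G$.
   Context: Graphs have no loops or parallel edges. For a graph $G$ and a partition $\mathcal P$ of $V(G)$ (whose parts are called blocks), $\mathcal P$ is $t$-thick if every block has at least $t$ vertices. An independent transversal of $\mathcal P$ in $G$ is an independent set of $G$ meeting each block of $\mathcal P$ in exactly one vertex. The degree $d(B)$ of a block $B$ is the number of edges of $G$ with precisely one endvertex in $B$, and the maximum block average degree of $\mathcal P$ is $\max_{B\in\mathcal P} d(B)/|B|$. The local degree of $G$ with respect to $\mathcal P$ is the maximum, over vertices $v$ and blocks $B\in\mathcal P$, of the number of neighbours of $v$ in $B$. *)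

theory Defs
  imports Complex_Main "HOL-Library.Ramsey" "HOL-Library.Disjoint_Sets"
begin

text \<open>
  A finite simple graph is given by its vertex set \<open>V\<close> and its edge set \<open>E\<close>, whose members are
  two-element subsets of \<open>V\<close>; loops and parallel edges are thereby excluded.
\<close>

definition simple_graph :: "'a set \<Rightarrow> 'a set set \<Rightarrow> bool" where
  "simple_graph V E \<longleftrightarrow> finite V \<and> E \<subseteq> nsets V 2"

definition independent_set :: "'a set \<Rightarrow> 'a set set \<Rightarrow> 'a set \<Rightarrow> bool" where
  "independent_set V E S \<longleftrightarrow> S \<subseteq> V \<and> (\<forall>e\<in>E. \<not> e \<subseteq> S)"

definition neighbours :: "'a set set \<Rightarrow> 'a \<Rightarrow> 'a set" where
  "neighbours E v = {u. {v, u} \<in> E}"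

definition thick :: "nat \<Rightarrow> 'a set set \<Rightarrow> bool" where
  "thick t P \<longleftrightarrow> (\<forall>B\<in>P. t \<le> card B)"

definition independent_transversal :: "'a set \<Rightarrow> 'a set set \<Rightarrow> 'a set set \<Rightarrow> 'a set \<Rightarrow> bool" where
  "independent_transversal V E P S \<longleftrightarrow>
     independent_set V E S \<and> (\<forall>B\<in>P. card (S \<inter> B) = 1)"

definition block_degree :: "'a set set \<Rightarrow> 'a set \<Rightarrow> nat" where
  "block_degree E B = card {e \<in> E. card (e \<inter> B) = 1}"

text \<open>
  The two maxima below are meaningful for partitions of a nonempty finite vertex set.  An empty
  partition has the empty set as an independent transversal.
\<close>

definition max_block_avg_degree :: "'a set set \<Rightarrow> 'a set set \<Rightarrow> real" where
  "max_block_avg_degree E P = Max ((\<lambda>B. real (block_degree E B) / real (card B)) ` P)"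

definition local_degree :: "'a set \<Rightarrow> 'a set set \<Rightarrow> 'a set set \<Rightarrow> nat" where
  "local_degree V E P = Max ((\<lambda>(v, B). card (neighbours E v \<inter> B)) ` (V \<times> P))"

end

theory Submission
  imports Defs "HOL-Library.Nat_Bijection"
begin

text \<open>
  Call a set of vertices unavoidable if every independent transversal meets it. Joining a new vertex
  \<open>v\<close> to all of an unavoidable set \<open>A\<close> of a disjoint graph prevents \<open>v\<close> from being used in an
  independent transversal, at the cost of \<open>card A\<close> edges at the block of \<open>v\<close>. Spending the budget
  of about \<open>(1/4 + \<epsilon>) t\<^sup>2\<close> edges at a new block of size \<open>t\<close> in this way, with a separate copy for
  each vertex, leaves an unavoidable set of size about \<open>t - (1/4 + \<epsilon>) t\<^sup>2 / card A\<close>. This is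
  smaller than \<open>card A\<close> by the inequality of arithmetic and geometric means, so iteration ends with
  an empty unavoidable set. To keep the local degree small, the iteration starts with two blocks and
  a complete bipartite graph between subsets of sizes about \<open>0.731 t\<close> and \<open>0.3415 t\<close>, whose
  complement is an unavoidable set of size about \<open>0.9275 t\<close>; one step then brings the size down to
  \<open>0.731 t\<close>.
\<close>

section \<open>Gadgets with an unavoidable set: base case and extension step\<close>

text \<open>The summand \<open>card (A \<inter> B)\<close> reserves room for the edges to one further vertex joined to \<open>A\<close>.\<close>

definition gadget ::
    "nat \<Rightarrow> nat \<Rightarrow> nat \<Rightarrow> 'a set \<Rightarrow> 'a set set \<Rightarrow> 'a set set \<Rightarrow> 'a set \<Rightarrow> bool" where
  "gadget t M L V E P A \<longleftrightarrow>
     simple_graph V E \<and> partition_on V P \<and> A \<subseteq> V \<and>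
     (\<forall>B\<in>P. card B = t \<and> block_degree E B + card (A \<inter> B) \<le> M \<and> card (A \<inter> B) \<le> L) \<and>
     (\<forall>v\<in>V. \<forall>B\<in>P. card (neighbours E v \<inter> B) \<le> L) \<and>
     (\<forall>S. independent_transversal V E P S \<longrightarrow> S \<inter> A \<noteq> {})"

text \<open>A transversal avoiding \<open>A\<close> would pick a vertex from each side of a complete
  bipartite graph, hence two adjacent vertices. In \<open>M\<close>, the product
  \<open>u * w\<close> pays for the edges and \<open>t\<close> for the reserve. Only the part of
  \<open>A\<close> in each block is kept below \<open>L\<close>; \<open>A\<close> itself may be
  larger.\<close>

lemma gadget_base:
  assumes t: "t > 0" and u: "u \<le> t" "u \<le> L" "t - u \<le> L" and w: "w \<le> t" "w \<le> L" "t - w \<le> L"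
    and M: "u * w + t \<le> M"
  shows "\<exists>(V::nat set) E P A. gadget t M L V E P A \<and> card A \<le> 2 * t - u - w"
proof -
  define E where "E = (\<lambda>(x, y). {x, y}) ` ({..<u} \<times> {t..<t + w})"
  define A where "A = {u..<t} \<union> {t + w..<2 * t}"
  define P where "P = {{..<t}, {t..<2 * t}}"
  let ?V = "{..<2 * t}"
  have memE: "{x, y} \<in> E \<longleftrightarrow> x < u \<and> y \<in> {t..<t+w} \<or> y < u \<and> x \<in> {t..<t+w}" for x y
    using u w by (auto simp: E_def image_iff doubleton_eq_iff)
  have "card E \<le> card ({..<u} \<times> {t..<t + w})"
    unfolding E_def by (intro card_image_le) auto
  then have cE: "card E \<le> u * w"
    by simp
  have finE: "finite E"
    by (simp add: E_def)
  have "block_degree E B \<le> u * w" for B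
    unfolding block_degree_def using card_mono[OF finE, of "{e \<in> E. card (e \<inter> B) = 1}"] cE by auto
  moreover have AI: "A \<inter> {..<t} = {u..<t}" "A \<inter> {t..<2 * t} = {t + w..<2 * t}"
    using u w by (auto simp: A_def)
  ultimately have B: "card B = t \<and> block_degree E B + card (A \<inter> B) \<le> M \<and> card (A \<inter> B) \<le> L"
    if "B \<in> P" for B
    using that M u w by (force simp: P_def AI intro: order_trans[OF add_mono M])
  have nb: "neighbours E v \<subseteq> {..<u} \<or> neighbours E v \<subseteq> {t..<t + w}" for v
    using u w by (auto simp: neighbours_def memE)
  have "card (neighbours E v \<inter> B) \<le> L" for v B
  proof -
    obtain N where "neighbours E v \<inter> B \<subseteq> N" "finite N" "card N \<le> L"
      using nb[of v] u w by (metis (no_types) card_atLeastLessThan card_lessThan diff_add_inverse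
          finite_atLeastLessThan finite_lessThan inf.coboundedI1)
    then show ?thesis
      using card_mono le_trans by blast
  qed
  moreover have "simple_graph ?V E"
    using u w by (auto simp: simple_graph_def E_def nsets_def card_insert_if)
  moreover have "partition_on ?V P"
    using t by (auto simp: partition_on_def P_def disjoint_def)
  moreover have "S \<inter> A \<noteq> {}" if "independent_transversal ?V E P S" for S
  proof
    assume SA: "S \<inter> A = {}"
    have "card (S \<inter> {..<t}) = 1" "card (S \<inter> {t..<2 * t}) = 1"
      and S: "\<And>e. e \<in> E \<Longrightarrow> \<not> e \<subseteq> S"
      using that by (auto simp: independent_transversal_def independent_set_def P_def)
    then obtain x y where x: "x \<in> S" "x < t" and y: "y \<in> S" "t \<le> y" "y < 2 * t"
      by (metis (no_types) Int_iff atLeastLessThan_iff card_1_singletonE insertI1 lessThan_iff)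
    then have "x < u" "y < t + w"
      using SA by (force simp: A_def)+
    then have "{x, y} \<in> E"
      using y by (simp add: memE)
    then show False
      using S x y by blast
  qed
  ultimately have "gadget t M L ?V E P A"
    using B by (auto simp: gadget_def A_def)
  moreover have "card A \<le> 2 * t - u - w"
    using u w card_Un_le[of "{u..<t}" "{t + w..<2 * t}"] by (simp add: A_def)
  ultimately show ?thesis
    by blast
qed

text \<open>The first \<open>k\<close> vertices of a new block are each joined to \<open>A\<close>
  in a private copy of the gadget. A transversal picking one of them meets \<open>A\<close> in that
  copy, which gives an edge; so it picks one of the other \<open>t - k\<close>, which form
  \<open>A'\<close>. The edges added at a copied block use up its reserve, and it needs no new one
  because \<open>A'\<close> lies in the new block.\<close>

lemma gadget_step:
  fixes V :: "nat set"
  assumes G: "gadget t M L V E P A" and t: "t > 0" and k: "k \<le> t"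
    and M: "k * card A + (t - k) \<le> M" and L: "t - k \<le> L" "L > 0"
  shows "\<exists>(V'::nat set) E' P' A'. gadget t M L V' E' P' A' \<and> card A' = t - k"
proof -
  \<comment> \<open>Tag \<open>0\<close> marks the new block and tag \<open>Suc i\<close> the copy
    owned by its vertex \<open>i\<close>. Pairing into \<open>nat\<close> keeps the vertex type
    fixed under iteration.\<close>
  define c where "c i x = prod_encode (i, x)" for i x :: nat
  have c[simp]: "c i x = c j y \<longleftrightarrow> i = j \<and> x = y" for i j x y
    by (auto simp: c_def)
  have inj: "inj_on (c i) X" for i X
    by (auto simp: inj_on_def)
  have cI[simp]: "c i x \<in> c j ` X \<longleftrightarrow> i = j \<and> x \<in> X" for i j x X
    by (auto simp: image_iff)
  define J where "J = (\<lambda>(i, a). {c 0 i, c (Suc i) a}) ` ({..<k} \<times> A)"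
  define E' where "E' = (\<Union>i<k. (`) (c (Suc i)) ` E) \<union> J"
  define N where "N = c 0 ` {..<t}"
  define V' where "V' = N \<union> (\<Union>i<k. c (Suc i) ` V)"
  define P' where "P' = insert N (\<Union>i<k. (`) (c (Suc i)) ` P)"
  define A' where "A' = c 0 ` {k..<t}"
  from G have sg: "simple_graph V E" and part: "partition_on V P" and AV: "A \<subseteq> V"
    and PB: "\<And>B. B \<in> P \<Longrightarrow> card B = t" "\<And>B. B \<in> P \<Longrightarrow> block_degree E B + card (A \<inter> B) \<le> M"
      "\<And>B. B \<in> P \<Longrightarrow> card (A \<inter> B) \<le> L"
    and loc: "\<And>v B. v \<in> V \<Longrightarrow> B \<in> P \<Longrightarrow> card (neighbours E v \<inter> B) \<le> L"
    and IT: "\<And>S. independent_transversal V E P S \<Longrightarrow> S \<inter> A \<noteq> {}"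
    by (auto simp: gadget_def)
  have finV: "finite V" and EV: "\<And>e. e \<in> E \<Longrightarrow> e \<subseteq> V \<and> card e = 2"
    using sg by (auto simp: simple_graph_def nsets_def)
  have finA: "finite A"
    using finV AV finite_subset by blast
  have finE: "finite E"
    using EV finV by (meson Pow_iff finite_Pow_iff finite_subset subsetI)
  have BV: "B \<subseteq> V" if "B \<in> P" for B
    using part that by (auto simp: partition_on_def)
  have "simple_graph V' E'"
    unfolding simple_graph_def
  proof (intro conjI subsetI)
    show "finite V'"
      by (simp add: V'_def N_def finV)
    fix e assume "e \<in> E'"
    then consider i f where "i < k" "f \<in> E" "e = c (Suc i) ` f"
      | i a where "i < k" "a \<in> A" "e = {c 0 i, c (Suc i) a}"
      by (auto simp: E'_def J_def)
    then show "e \<in> nsets V' 2"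
    proof cases
      case 1
      then show ?thesis
        using EV[of f] finV by (auto simp: nsets_def V'_def card_image[OF inj] intro: finite_subset)
    next
      case 2
      then show ?thesis
        using AV k by (auto simp: nsets_def V'_def N_def)
    qed
  qed
  moreover have "partition_on V' P'"
  proof (rule partition_onI)
    show "\<Union> P' = V'"
      using part by (auto simp: P'_def V'_def partition_on_def)
    show "{} \<notin> P'"
      using part t by (auto simp: P'_def N_def partition_on_def)
    have "disjnt p q" if "p \<in> P" "q \<in> P" "p \<noteq> q" for p q
      using that part by (auto simp: partition_on_def disjoint_def disjnt_def)
    then show "disjnt p q" if "p \<in> P'" "q \<in> P'" "p \<noteq> q" for p q
      using that by (fastforce simp: P'_def N_def disjnt_iff)
  qed
  moreover have "A' \<subseteq> V'"
    by (auto simp: A'_def V'_def N_def)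
  moreover have "card B' = t \<and> block_degree E' B' + card (A' \<inter> B') \<le> M \<and> card (A' \<inter> B') \<le> L"
    if "B' \<in> P'" for B'
  proof -
    from that consider "B' = N" | i B where "i < k" "B \<in> P" "B' = c (Suc i) ` B"
      by (auto simp: P'_def)
    then show ?thesis
    proof cases
      case 1
      \<comment> \<open>Copied edges have no endpoint with tag \<open>0\<close>, so only joining
        edges contribute.\<close>
      have "{e \<in> E'. card (e \<inter> N) = 1} \<subseteq> J"
      proof
        fix e assume e: "e \<in> {e \<in> E'. card (e \<inter> N) = 1}"
        then have "e \<inter> N \<noteq> {}"
          by auto
        with e show "e \<in> J"
          by (auto simp: E'_def N_def)
      qed
      then have "block_degree E' N \<le> card J"
        unfolding block_degree_def by (intro card_mono) (auto simp: J_def finA)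
      also have "\<dots> \<le> card ({..<k} \<times> A)"
        unfolding J_def by (intro card_image_le) (auto simp: finA)
      finally have "block_degree E' N \<le> k * card A"
        by (simp add: card_cartesian_product)
      moreover have "A' \<inter> N = A'" "card A' = t - k" "card N = t"
        by (auto simp: A'_def N_def card_image[OF inj])
      ultimately show ?thesis
        using 1 M L by auto
    next
      case 2
      let ?J = "(\<lambda>a. {c 0 i, c (Suc i) a}) ` (A \<inter> B)"
      let ?D = "{e \<in> E. card (e \<inter> B) = 1}"
      \<comment> \<open>An edge leaving the copy of \<open>B\<close> either comes from an edge
        leaving \<open>B\<close> or joins the owner of this copy to a vertex of
        \<open>A \<inter> B\<close>.\<close>
      have "{e \<in> E'. card (e \<inter> B') = 1} \<subseteq> (`) (c (Suc i)) ` ?D \<union> ?J"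
      proof
        fix e assume e: "e \<in> {e \<in> E'. card (e \<inter> B') = 1}"
        then have ne: "e \<inter> B' \<noteq> {}"
          by auto
        from e consider j f where "j < k" "f \<in> E" "e = c (Suc j) ` f"
          | j a where "j < k" "a \<in> A" "e = {c 0 j, c (Suc j) a}"
          by (auto simp: E'_def J_def)
        then show "e \<in> (`) (c (Suc i)) ` ?D \<union> ?J"
        proof cases
          case f: 1
          then have "j = i"
            using ne 2 by auto
          then have "e \<inter> B' = c (Suc i) ` (f \<inter> B)"
            using f 2 by auto
          then have "card (f \<inter> B) = 1"
            using e by (simp add: card_image[OF inj])
          then show ?thesis
            using f \<open>j = i\<close> by blast
        next
          case a: 2
          then show ?thesis
            using ne 2 by auto
        qed
      qed
      then have "block_degree E' B' \<le> card ((`) (c (Suc i)) ` ?D \<union> ?J)"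
        unfolding block_degree_def by (intro card_mono) (auto simp: finA finE)
      also have "\<dots> \<le> card ?D + card (A \<inter> B)"
        by (intro order_trans[OF card_Un_le] add_mono card_image_le) (auto simp: finA finE)
      also have "\<dots> \<le> M"
        using PB(2)[OF 2(2)] by (simp add: block_degree_def)
      finally have "block_degree E' B' \<le> M" .
      moreover have "A' \<inter> B' = {}"
        using 2 by (auto simp: A'_def)
      ultimately show ?thesis
        using 2 PB(1) by (auto simp: card_image[OF inj])
    qed
  qed
  moreover have "card (neighbours E' v \<inter> B') \<le> L" if "v \<in> V'" "B' \<in> P'" for v B'
  proof -
    have mem0: "{c 0 i, y} \<in> E' \<longleftrightarrow> i < k \<and> (\<exists>a\<in>A. y = c (Suc i) a)" for i y
    proof -
      have "{c 0 i, y} \<noteq> c (Suc l) ` f" for l f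
        using cI[of 0 i "Suc l" f] by blast
      then show ?thesis
        by (auto simp: E'_def J_def doubleton_eq_iff)
    qed
    have memS: "{c (Suc i) x, c (Suc j) y} \<in> E' \<longleftrightarrow> i < k \<and> i = j \<and> {x, y} \<in> E" for i j x y
    proof
      assume "{c (Suc i) x, c (Suc j) y} \<in> E'"
      moreover have "{c (Suc i) x, c (Suc j) y} \<notin> J"
        by (auto simp: J_def doubleton_eq_iff)
      ultimately obtain l f where f: "l < k" "f \<in> E" "{c (Suc i) x, c (Suc j) y} = c (Suc l) ` f"
        unfolding E'_def by blast
      then have "c (Suc i) x \<in> c (Suc l) ` f" "c (Suc j) y \<in> c (Suc l) ` f"
        by blast+
      then have ij: "i = l" "j = l"
        by auto
      then have "c (Suc l) ` {x, y} = c (Suc l) ` f"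
        using f by auto
      then have "{x, y} = f"
        by (simp only: inj_image_eq_iff[OF inj])
      then show "i < k \<and> i = j \<and> {x, y} \<in> E"
        using ij f by auto
    next
      assume *: "i < k \<and> i = j \<and> {x, y} \<in> E"
      then have "{c (Suc i) x, c (Suc j) y} = c (Suc i) ` {x, y}"
        by auto
      with * show "{c (Suc i) x, c (Suc j) y} \<in> E'"
        unfolding E'_def by blast
    qed
    from that(2) consider (new) "B' = N" | (copy) j B where "j < k" "B \<in> P" "B' = c (Suc j) ` B"
      by (auto simp: P'_def)
    note cases_B' = this
    from that(1) consider (new) i where "v = c 0 i" | (copy) i x where "x \<in> V" "v = c (Suc i) x"
      by (auto simp: V'_def N_def)
    then show ?thesis
    proof cases
      case v: new
      from cases_B' show ?thesis
      proof cases
        case new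
        with v have "neighbours E' v \<inter> B' = {}"
          by (auto simp: neighbours_def mem0 N_def)
        then show ?thesis
          by simp
      next
        case copy
        with v have "neighbours E' v \<inter> B' \<subseteq> c (Suc j) ` (A \<inter> B)"
          by (auto simp: neighbours_def mem0)
        then have "card (neighbours E' v \<inter> B') \<le> card (A \<inter> B)"
          using finA by (intro surj_card_le) auto
        then show ?thesis
          using PB(3)[OF copy(2)] by simp
      qed
    next
      case v: copy
      from cases_B' show ?thesis
      proof cases
        case new
        \<comment> \<open>In the new block a copied vertex can only see the owner of its copy;
          \<open>L > 0\<close> allows for this one neighbour.\<close>
        with v have "neighbours E' v \<inter> B' \<subseteq> {c 0 i}"
          by (auto simp: neighbours_def insert_commute[of "c (Suc i) x"] mem0 N_def)
        then have "card (neighbours E' v \<inter> B') \<le> card {c 0 i}"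
          by (intro card_mono) auto
        then show ?thesis
          using L by simp
      next
        case copy
        with v have "neighbours E' v \<inter> B' \<subseteq> c (Suc j) ` (neighbours E x \<inter> B)"
          by (auto simp: neighbours_def memS)
        moreover have "finite (neighbours E x \<inter> B)"
          using BV[OF copy(2)] finV finite_subset by blast
        ultimately have "card (neighbours E' v \<inter> B') \<le> card (neighbours E x \<inter> B)"
          by (intro surj_card_le)
        then show ?thesis
          using loc[OF v(1) copy(2)] by simp
      qed
    qed
  qed
  moreover have "S \<inter> A' \<noteq> {}" if S: "independent_transversal V' E' P' S" for S
  proof -
    have SB: "\<And>B. B \<in> P' \<Longrightarrow> card (S \<inter> B) = 1" and SE: "\<And>e. e \<in> E' \<Longrightarrow> \<not> e \<subseteq> S"
      using S by (auto simp: independent_transversal_def independent_set_def)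
    have "card (S \<inter> N) = 1"
      using SB by (simp add: P'_def)
    then have "S \<inter> N \<noteq> {}"
      by auto
    then obtain j where j: "j < t" "c 0 j \<in> S"
      by (auto simp: N_def)
    have "\<not> j < k"
    proof
      assume "j < k"
      \<comment> \<open>The pullback of \<open>S\<close> to copy \<open>j\<close> is a transversal
        of the old gadget, so it contains some \<open>a\<close> in \<open>A\<close>; the edge from
        vertex \<open>j\<close> to the copy of \<open>a\<close> then lies inside
        \<open>S\<close>.\<close>
      define T where "T = {x \<in> V. c (Suc j) x \<in> S}"
      have "card (T \<inter> B) = 1" if "B \<in> P" for B
      proof -
        have "c (Suc j) ` (T \<inter> B) = S \<inter> c (Suc j) ` B"
          using BV[OF that] by (auto simp: T_def)
        moreover have "c (Suc j) ` B \<in> P'"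
          using that \<open>j < k\<close> by (auto simp: P'_def)
        ultimately show ?thesis
          using SB by (metis card_image inj)
      qed
      moreover have "\<not> e \<subseteq> T" if "e \<in> E" for e
      proof
        assume "e \<subseteq> T"
        then have "c (Suc j) ` e \<subseteq> S"
          by (auto simp: T_def)
        moreover have "c (Suc j) ` e \<in> E'"
          using that \<open>j < k\<close> by (auto simp: E'_def)
        ultimately show False
          using SE by blast
      qed
      ultimately have "independent_transversal V E P T"
        by (auto simp: independent_transversal_def independent_set_def T_def)
      then obtain a where "a \<in> T" "a \<in> A"
        using IT by blast
      then have "{c 0 j, c (Suc j) a} \<in> E'" "{c 0 j, c (Suc j) a} \<subseteq> S"
        using \<open>j < k\<close> j by (auto simp: E'_def J_def T_def)
      then show False
        using SE by blast
    qed
    then have "c 0 j \<in> S \<inter> A'"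
      using j by (auto simp: A'_def)
    then show ?thesis
      by blast
  qed
  ultimately have "gadget t M L V' E' P' A'"
    by (auto simp: gadget_def)
  moreover have "card A' = t - k"
    by (simp add: A'_def card_image[OF inj])
  ultimately show ?thesis
    by blast
qed

section \<open>Iteration down to an empty unavoidable set\<close>

text \<open>Taking \<open>k\<close> as large as the edge budget \<open>D\<close> permits strictly
  shrinks the unavoidable set, so strong induction on its size applies, and
  \<open>card A \<le> L\<close> persists. The additional \<open>t\<close> covers the reserve
  \<open>t - k\<close>; the \<open>1\<close> in \<open>(t + 1)\<^sup>2\<close> makes up for rounding
  \<open>D / card A\<close> down.\<close>

lemma gadget_empty:
  fixes V :: "nat set"
  assumes "gadget t (D + t) L V E P A" "card A \<le> L" "t > 0" "L > 0" "(t + 1)\<^sup>2 \<le> 4 * D"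
  shows "\<exists>(V::nat set) E P. gadget t (D + t) L V E P {}"
  using assms(1,2)
proof (induction "card A" arbitrary: V E P A rule: less_induct)
  case less
  show ?case
  proof (cases "card A = 0")
    case True
    have "finite A"
      using less.prems(1) by (auto simp: gadget_def simple_graph_def intro: finite_subset)
    then have "A = {}"
      using True by simp
    then show ?thesis
      using less.prems by blast
  next
    case False
    define q where "q = D div card A"
    define k where "k = min t q"
    have "t - k < card A"
    proof (cases "t \<le> q")
      case True
      then show ?thesis
        using False by (simp add: k_def)
    next
      case k: False
      have "t < card A + q"
      proof (rule ccontr)
        assume "\<not> t < card A + q"
        then have le: "card A + (q + 1) \<le> t + 1"
          by simp
        \<comment> \<open>Rounding down gives \<open>D < card A * (q + 1)\<close>, and four times a
          product is at most the square of the sum of its factors.\<close>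
        have "4 * D < 4 * (card A * (q + 1))"
          using False dividend_less_times_div[of "card A" D] by (simp add: q_def)
        also have "\<dots> \<le> (card A + (q + 1))\<^sup>2"
          using sum_squares_bound[of "real (card A)" "real (q + 1)"]
          unfolding of_nat_le_iff[where 'a = real, symmetric]
          by (simp add: power2_eq_square algebra_simps)
        also have "\<dots> \<le> (t + 1)\<^sup>2"
          using le by (rule power_mono) simp
        finally show False
          using assms(5) by simp
      qed
      then show ?thesis
        using k by (simp add: k_def)
    qed
    moreover have "k * card A \<le> D"
      using le_trans[OF mult_le_mono1 div_times_less_eq_dividend] by (simp add: k_def q_def)
    then have "k * card A + (t - k) \<le> D + t"
      by simp
    ultimately obtain V' :: "nat set" and E' P' A'
      where "gadget t (D + t) L V' E' P' A'" "card A' = t - k"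
      using gadget_step[OF less.prems(1) assms(3), of k] less.prems(2) assms(4)
      by (auto simp: k_def)
    then show ?thesis
      using less.hyps \<open>t - k < card A\<close> less.prems(2) by (metis less_imp_le_nat order_trans)
  qed
qed

text \<open>No transversal can meet the empty set, and all reserves vanish, so \<open>M\<close>
  bounds the block degrees themselves.\<close>

lemma gadget_emptyD:
  assumes "gadget t M L V E P {}" "t > 0"
  shows "thick t P" "max_block_avg_degree E P \<le> real M / real t" "local_degree V E P \<le> L"
    "\<not> independent_transversal V E P S"
proof -
  have G: "simple_graph V E" "partition_on V P"
    "\<And>B. B \<in> P \<Longrightarrow> card B = t \<and> block_degree E B \<le> M"
    "\<And>v B. v \<in> V \<Longrightarrow> B \<in> P \<Longrightarrow> card (neighbours E v \<inter> B) \<le> L"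
    and nIT: "\<And>S. \<not> independent_transversal V E P S"
    using assms(1) by (auto simp: gadget_def)
  show "thick t P" "\<not> independent_transversal V E P S"
    using G nIT by (auto simp: thick_def)
  have fin: "finite V" "finite P"
    using G finite_elements[of V P] by (auto simp: simple_graph_def)
  \<comment> \<open>Bounding \<open>Max\<close> requires nonempty sets. An empty partition would
    have the empty set as a transversal.\<close>
  have "P \<noteq> {}"
  proof
    assume "P = {}"
    moreover from this have "E = {}"
      using G by (auto simp: partition_on_def simple_graph_def nsets_def)
    ultimately have "independent_transversal V E P {}"
      by (simp add: independent_transversal_def independent_set_def)
    with nIT show False
      by blast
  qed
  moreover have "V \<noteq> {}"
    using G(2) \<open>P \<noteq> {}\<close> by (auto simp: partition_on_def)
  ultimately show "max_block_avg_degree E P \<le> real M / real t" "local_degree V E P \<le> L"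
    using G fin unfolding max_block_avg_degree_def local_degree_def
    by (auto intro!: Max.boundedI divide_right_mono)
qed

section \<open>Choice of parameters for large block size\<close>

theorem theorem3p2:
  shows "\<forall>\<epsilon>::real. \<epsilon> > 0 \<longrightarrow>
    (\<exists>t0::nat. \<forall>t::nat. t \<ge> t0 \<longrightarrow>
      (\<exists>(V :: nat set) E P.
         simple_graph V E \<and> partition_on V P \<and> thick t P \<and>
         max_block_avg_degree E P \<le> (1/4 + \<epsilon>) * real t \<and>
         real (local_degree V E P) \<le> 0.731 * real t \<and>
         \<not> (\<exists>S. independent_transversal V E P S)))"
proof (intro allI impI, rule exI, intro allI impI)
  fix \<epsilon> :: real and t :: nat
  \<comment> \<open>The threshold \<open>11 / (4 * \<epsilon>)\<close> makes
    \<open>\<epsilon> * t\<^sup>2\<close> at least \<open>11/4 * t\<close>, a linear slack for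
    rounding and reserves; \<open>10000\<close> settles the remaining numerical estimates.\<close>
  assume \<epsilon>: "\<epsilon> > 0" and "max 10000 (nat \<lceil>11 / (4 * \<epsilon>)\<rceil>) \<le> t"
  then have t: "real t \<ge> 10000" and t\<epsilon>: "11 / (4 * \<epsilon>) \<le> real t"
    by linarith+
  define x where "x = real t"
  have x: "x \<ge> 10000" "x > 0"
    using t by (auto simp: x_def)
  \<comment> \<open>The first two graphs need \<open>L * w\<close> and
    \<open>(t - L) * (2 * t - L - w)\<close> to fit into about \<open>t\<^sup>2 / 4\<close>. With 2
    - 0.731 - 0.3415 = 0.9275, the products 0.731 * 0.3415 and 0.269 * 0.9275 are both just below
    1/4.\<close>
  define L where "L = nat \<lfloor>731/1000 * x\<rfloor>"
  define w where "w = nat \<lfloor>3415/10000 * x\<rfloor>"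
  define M where "M = nat \<lfloor>(1/4 + \<epsilon>) * x\<^sup>2\<rfloor>"
  have L: "real L \<le> 731/1000 * x" "731/1000 * x < real L + 1"
    using x unfolding L_def by linarith+
  have w: "real w \<le> 3415/10000 * x" "3415/10000 * x < real w + 1"
    using x unfolding w_def by linarith+
  have "(1/4 + \<epsilon>) * x\<^sup>2 \<ge> 0"
    using \<epsilon> by simp
  then have M: "real M \<le> (1/4 + \<epsilon>) * x\<^sup>2" "(1/4 + \<epsilon>) * x\<^sup>2 < real M + 1"
    unfolding M_def by linarith+
  have "11 * x \<le> 4 * \<epsilon> * x\<^sup>2"
    using t\<epsilon> \<epsilon> x by (simp add: x_def[symmetric] field_simps power2_eq_square)
  then have M1: "x\<^sup>2 + 11 * x < 4 * real M + 4"
    using M(2) by (simp add: algebra_simps)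
  have xx: "10000 * x \<le> x\<^sup>2"
    using x by (simp add: power2_eq_square)
  have tL: "L \<le> t" "w \<le> t" "w \<le> L" "t - L \<le> L" "t - w \<le> L" "L > 0" "t > 0"
    using L w x unfolding x_def by linarith+
  have "real L * real w \<le> (731/1000 * x) * (3415/10000 * x)"
    using L w x by (intro mult_mono) auto
  then have "real L * real w + x \<le> real M"
    using M1 xx x by (simp add: power2_eq_square)
  then have "L * w + t \<le> M"
    unfolding x_def by (metis of_nat_add of_nat_le_iff of_nat_mult)
  then obtain V0 :: "nat set" and E0 P0 A0
    where G0: "gadget t M L V0 E0 P0 A0" and A0: "card A0 \<le> 2 * t - L - w"
    using gadget_base[of t L L w M] tL by blast
  \<comment> \<open>The summand \<open>2\<close> absorbs the rounding of \<open>L\<close> and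
    \<open>w\<close>.\<close>
  have "real (card A0) \<le> 9275/10000 * x + 2"
    using A0 L w tL unfolding x_def by linarith
  moreover have "real (t - L) \<le> 269/1000 * x + 1"
    using L tL unfolding x_def by linarith
  ultimately have "real (t - L) * real (card A0) \<le> (269/1000 * x + 1) * (9275/10000 * x + 2)"
    using x by (intro mult_mono) auto
  also have "\<dots> + x \<le> real M"
    using M1 xx x by (simp add: power2_eq_square algebra_simps)
  finally have "real ((t - L) * card A0 + t) \<le> real M"
    by (simp add: x_def)
  then have "(t - L) * card A0 + (t - (t - L)) \<le> M"
    by (simp only: of_nat_le_iff)
  \<comment> \<open>The choice \<open>k = t - L\<close> leaves exactly \<open>L\<close> unavoidable
    vertices, as the iteration allows. \<open>A0\<close> itself may exceed \<open>L\<close>, since a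
    gadget bounds only its part in each block.\<close>
  then obtain V1 :: "nat set" and E1 P1 A1
    where G1: "gadget t M L V1 E1 P1 A1" and A1: "card A1 = t - (t - L)"
    using gadget_step[OF G0, of "t - L"] tL by auto
  \<comment> \<open>The term \<open>4 * x\<close> sets the reserve \<open>t\<close> aside; the
    remaining \<open>M - t\<close> serves as the edge budget \<open>D\<close>.\<close>
  have "(x + 1)\<^sup>2 + 4 * x \<le> 4 * real M"
    using M1 x by (simp add: power2_eq_square algebra_simps)
  then have "real ((t + 1)\<^sup>2 + 4 * t) \<le> real (4 * M)"
    by (simp add: x_def add.commute)
  then have D: "(t + 1)\<^sup>2 + 4 * t \<le> 4 * M"
    by (simp only: of_nat_le_iff)
  then have "M - t + t = M" "(t + 1)\<^sup>2 \<le> 4 * (M - t)"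
    by simp_all
  then obtain V :: "nat set" and E P where G: "gadget t M L V E P {}"
    using gadget_empty[of t "M - t" L V1 E1 P1 A1] G1 A1 tL by auto
  have "real M / x \<le> (1/4 + \<epsilon>) * x"
    using M(1) x by (simp add: field_simps power2_eq_square)
  then have "max_block_avg_degree E P \<le> (1/4 + \<epsilon>) * real t"
    "real (local_degree V E P) \<le> 0.731 * real t"
    using gadget_emptyD(2,3)[OF G tL(7)] L(1) unfolding x_def by auto
  then show "\<exists>(V :: nat set) E P.
         simple_graph V E \<and> partition_on V P \<and> thick t P \<and>
         max_block_avg_degree E P \<le> (1/4 + \<epsilon>) * real t \<and>
         real (local_degree V E P) \<le> 0.731 * real t \<and>
         \<not> (\<exists>S. independent_transversal V E P S)"
    using G gadget_emptyD(1,4)[OF G tL(7)] unfolding gadget_def by blast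
qed

end
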